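(* Let $f:I\to\mathbb{R}$ be a strictly increasing function. Then the following conditions are equivalent: (i) The function $f$ is continuous on $I$. (ii) There exist $n\in\mathbb{N}\setminus\{1\}$ and a continuous, strictly increasing function $g:I\to\mathbb{R}$ such that $A^{[n]}_{f}=A^{[n]}_{g}$ holds on $I^n$. (iii) There exist $n\in\mathbb{N}\setminus\{1\}$ and a continuous, strictly increasing function $g:I\to\mathbb{R}$ such that either $A^{[n]}_{f}\le A^{[n]}_{g}$ holds on $I^n$ or $A^{[n]}_{g}\le A^{[n]}_{f}$ holds on $I^n$. (iv) There exists $n\in\mathbb{N}\setminus\{1\}$ such that $A^{[n]}_{f}$ is continuous. (v) There exists $n\in\mathbb{N}\setminus\{1\}$ such that $A^{[n]}_{f_+}\leq A^{[n]}_{f_-}$ holds on $I^n$. (vi) There exists $n\in\mathbb{N}\setminus\{1\}$ such that $A^{[n]}_{f}$ is strictly increasing (in each of its variables, the others being fixed). (vii) There exists $n\in\mathbb{N}\setminus\{1\}$ such that $A^{[n]}_{f}$ is strict, that is, $\min(x)<A^{[n]}_{f}(x)<\max(x)$ for every non-diagonal vector $x\in I^n$ (i.e., every $x\in I^n$ whose coordinates are not all equal). (viii) The sequence $(A_{f}^{[n]})_{n\in\mathbb{N}}$ is associative, that is, for all $n\in\mathbb{N}$, all $k\in\{1,\dots,n-1\}$ and all $x\in I^n$, $$A_f^{[n]}(x)=A_f^{[n]}(\underbrace{y,\dots,y}_{k\text{ times}},x_{k+1},\dots,x_n),\qquad\text{where } y:=A_f^{[k]}(x_1,\dots,x_k).$$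 Moreover, if any of the conditions (i)--(viii) holds, then the properties whose existence for some $n\in\mathbb{N}\setminus\{1\}$ is asserted in (iii)--(vii) are valid for all $n\in\mathbb{N}$.
   Context: $I$ is a nonempty open subinterval of $\mathbb{R}$. "Increasing" means nondecreasing; $\mathrm{conv}(S)$ is the smallest interval containing $S\subseteq\mathbb{R}$. For a strictly increasing (not necessarily continuous) $f:I\to\mathbb{R}$, it is known that there is a unique increasing function $f^{(-1)}:\mathrm{conv}(f(I))\to I$ with $f^{(-1)}(f(x))=x$ for all $x\in I$ (the generalized inverse of $f$; it is continuous). For $n\in\mathbb{N}=\{1,2,\dots\}$ the $n$-variable generalized quasiarithmetic mean $A_f^{[n]}:I^n\to I$ is $$A^{[n]}_{f}(x):=f^{(-1)}\Big(\frac{f(x_1)+\dots+f(x_n)}{n}\Big)\qquad(x\in I^n).$$ When $f$ is continuous this is the standard quasiarithmetic mean. The lower and upper semicontinuous envelopes of a strictly increasing $f$ are $f_-(x):=\lim_{r\to0+}\inf_{u\in(x-r,x+r)\cap I}f(u)$ and $f_+(x):=\lim_{r\to0+}\sup_{u\in(x-r,x+r)\cap I}f(u)$, $x\in I$; these equal the left and right limits of $f$ at $x$, and are themselves strictly increasing functions on $I$. *)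

theory Defs
  imports "HOL-Analysis.Analysis"
begin

text \<open>
  A point of \<open>I\<^sup>n\<close> is an extensional function in \<open>{1..n} \<rightarrow>\<^sub>E I\<close>. Since all
  these functions agree outside \<open>{1..n}\<close>, the topology that this set inherits from the product
  topology on \<open>nat \<Rightarrow> real\<close> is the usual topology of \<open>I\<^sup>n\<close>.
\<close>

text \<open>
  Real functions on \<open>I\<close> are total functions of which only the values on \<open>I\<close> matter. The
  generalized inverse is taken among extensional functions on \<open>conv (f(I))\<close>; this makes it
  unique as a HOL function (see \<open>gen_inverse_ex1\<close> below).
\<close>

definition gen_inverse :: "real set \<Rightarrow> (real \<Rightarrow> real) \<Rightarrow> real \<Rightarrow> real" where
  "gen_inverse I f =
     (THE h. h \<in> (convex hull (f ` I)) \<rightarrow>\<^sub>E I \<and> mono_on (convex hull (f ` I)) h \<and>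
             (\<forall>x\<in>I. h (f x) = x))"

definition qa_mean :: "real set \<Rightarrow> (real \<Rightarrow> real) \<Rightarrow> nat \<Rightarrow> (nat \<Rightarrow> real) \<Rightarrow> real" where
  "qa_mean I f n x = gen_inverse I f ((\<Sum>i=1..n. f (x i)) / real n)"

text \<open>
  The infimum (supremum) below is over a set that may be unbounded for large \<open>r\<close>; only small
  \<open>r\<close> contribute to the limit.
\<close>

definition lower_env :: "real set \<Rightarrow> (real \<Rightarrow> real) \<Rightarrow> real \<Rightarrow> real" where
  "lower_env I f x = Lim (at_right 0) (\<lambda>r. INF u\<in>{x - r<..<x + r} \<inter> I. f u)"

definition upper_env :: "real set \<Rightarrow> (real \<Rightarrow> real) \<Rightarrow> real \<Rightarrow> real" where
  "upper_env I f x = Lim (at_right 0) (\<lambda>r. SUP u\<in>{x - r<..<x + r} \<inter> I. f u)"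

definition equals_continuous_qa :: "real set \<Rightarrow> (real \<Rightarrow> real) \<Rightarrow> nat \<Rightarrow> bool" where
  "equals_continuous_qa I f n \<longleftrightarrow>
     (\<exists>g. continuous_on I g \<and> strict_mono_on I g \<and>
          (\<forall>x \<in> {1..n} \<rightarrow>\<^sub>E I. qa_mean I f n x = qa_mean I g n x))"

definition comparable_continuous_qa :: "real set \<Rightarrow> (real \<Rightarrow> real) \<Rightarrow> nat \<Rightarrow> bool" where
  "comparable_continuous_qa I f n \<longleftrightarrow>
     (\<exists>g. continuous_on I g \<and> strict_mono_on I g \<and>
          ((\<forall>x \<in> {1..n} \<rightarrow>\<^sub>E I. qa_mean I f n x \<le> qa_mean I g n x) \<or>
           (\<forall>x \<in> {1..n} \<rightarrow>\<^sub>E I. qa_mean I g n x \<le> qa_mean I f n x)))"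

definition strict_mono_each_var :: "real set \<Rightarrow> nat \<Rightarrow> ((nat \<Rightarrow> real) \<Rightarrow> real) \<Rightarrow> bool" where
  "strict_mono_each_var I n M \<longleftrightarrow>
     (\<forall>x \<in> {1..n} \<rightarrow>\<^sub>E I. \<forall>i\<in>{1..n}. strict_mono_on I (\<lambda>t. M (x(i := t))))"

definition strict_mean :: "real set \<Rightarrow> nat \<Rightarrow> ((nat \<Rightarrow> real) \<Rightarrow> real) \<Rightarrow> bool" where
  "strict_mean I n M \<longleftrightarrow>
     (\<forall>x \<in> {1..n} \<rightarrow>\<^sub>E I. (\<exists>i\<in>{1..n}. \<exists>j\<in>{1..n}. x i \<noteq> x j) \<longrightarrow>
        Min (x ` {1..n}) < M x \<and> M x < Max (x ` {1..n}))"

definition associative_means :: "real set \<Rightarrow> (nat \<Rightarrow> (nat \<Rightarrow> real) \<Rightarrow> real) \<Rightarrow> bool" where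
  "associative_means I M \<longleftrightarrow>
     (\<forall>n\<ge>1. \<forall>k\<in>{1..n-1}. \<forall>x \<in> {1..n} \<rightarrow>\<^sub>E I.
        (let y = M k (restrict x {1..k})
         in M n x = M n (\<lambda>i\<in>{1..n}. if i \<le> k then y else x i)))"

lemma gen_inverse_ex1:
  fixes I :: "real set" and f :: "real \<Rightarrow> real"
  assumes "is_interval I" "strict_mono_on I f"
  shows "\<exists>!h. h \<in> (convex hull (f ` I)) \<rightarrow>\<^sub>E I \<and> mono_on (convex hull (f ` I)) h \<and>
             (\<forall>x\<in>I. h (f x) = x)"
proof -
  let ?C = "convex hull (f ` I)"
  have sm: "f x < f y \<longleftrightarrow> x < y" if "x \<in> I" "y \<in> I" for x y
    using strict_mono_onD[OF assms(2) that] strict_mono_onD[OF assms(2) that(2,1)]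
    by (cases x y rule: linorder_cases) auto
  have sme: "f x \<le> f y \<longleftrightarrow> x \<le> y" if "x \<in> I" "y \<in> I" for x y
    using sm[OF that(2,1)] by (simp flip: linorder_not_less)
  have bd: "\<exists>a\<in>I. \<exists>b\<in>I. f a \<le> y \<and> y \<le> f b" if "y \<in> ?C" for y
  proof -
    let ?D = "{y. \<exists>a\<in>I. \<exists>b\<in>I. f a \<le> y \<and> y \<le> f b}"
    have "convex ?D"
      unfolding is_interval_convex_1[symmetric] is_interval_1 by (auto intro: order_trans)
    moreover have "f ` I \<subseteq> ?D" by auto
    ultimately have "?C \<subseteq> ?D" by (rule hull_minimal[OF _ , rotated])
    then show ?thesis using that by auto
  qed
  have fC: "f x \<in> ?C" if "x \<in> I" for x using that by (simp add: hull_inc)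
  have iv: "z \<in> I" if "a \<in> I" "b \<in> I" "a \<le> z" "z \<le> b" for a b z
    using assms(1) that unfolding is_interval_1 by blast
  define h where "h = (\<lambda>y\<in>?C. Sup {x\<in>I. f x \<le> y})"
  have bdd: "bdd_above {x\<in>I. f x \<le> y}" and ne: "{x\<in>I. f x \<le> y} \<noteq> {}" if y: "y \<in> ?C" for y
  proof -
    from bd[OF y] obtain a b where ab: "a \<in> I" "b \<in> I" "f a \<le> y" "y \<le> f b" by blast
    show "bdd_above {x\<in>I. f x \<le> y}"
      using ab(4) by (intro bdd_aboveI[of _ b]) (auto simp flip: sme[OF _ ab(2)])
    show "{x\<in>I. f x \<le> y} \<noteq> {}" using ab by auto
  qed
  have hI: "h y \<in> I" if y: "y \<in> ?C" for y
  proof -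
    from bd[OF y] obtain a b where ab: "a \<in> I" "b \<in> I" "f a \<le> y" "y \<le> f b" by blast
    have "a \<le> Sup {x\<in>I. f x \<le> y}" using ab bdd[OF y] by (intro cSup_upper) auto
    moreover have "Sup {x\<in>I. f x \<le> y} \<le> b"
      using ab(4) by (intro cSup_least[OF ne[OF y]]) (auto simp flip: sme[OF _ ab(2)])
    ultimately have "Sup {x\<in>I. f x \<le> y} \<in> I" by (rule iv[OF ab(1,2)])
    then show ?thesis using y by (simp add: h_def)
  qed
  have hm: "mono_on ?C h"
  proof (rule mono_onI)
    fix r s assume "r \<in> ?C" "s \<in> ?C" "r \<le> s"
    then show "h r \<le> h s" unfolding h_def
      by (simp, intro cSup_subset_mono ne bdd) auto
  qed
  have hf: "h (f x) = x" if x: "x \<in> I" for x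
  proof -
    have "{z\<in>I. f z \<le> f x} = {z\<in>I. z \<le> x}" using sme x by auto
    moreover have "Sup {z\<in>I. z \<le> x} = x" using x by (intro cSup_eq_maximum) auto
    ultimately show ?thesis using fC[OF x] by (simp add: h_def)
  qed
  have lt: False
    if g: "\<And>y. y \<in> ?C \<Longrightarrow> g y \<in> I" "mono_on ?C g" "\<And>x. x \<in> I \<Longrightarrow> g (f x) = x"
    and k: "\<And>y. y \<in> ?C \<Longrightarrow> k y \<in> I" "mono_on ?C k" "\<And>x. x \<in> I \<Longrightarrow> k (f x) = x"
    and y: "y \<in> ?C" "g y < k y" for g k y
  proof -
    obtain t where t: "g y < t" "t < k y" using y(2) dense by blast
    have tI: "t \<in> I" using iv[OF g(1)[OF y(1)] k(1)[OF y(1)]] t by simp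
    show False
    proof (cases "f t \<le> y")
      case True
      then have "g (f t) \<le> g y" using mono_onD[OF g(2) fC[OF tI] y(1)] by simp
      then show False using g(3)[OF tI] t by simp
    next
      case False
      then have "k y \<le> k (f t)" using mono_onD[OF k(2) y(1) fC[OF tI]] by simp
      then show False using k(3)[OF tI] t by simp
    qed
  qed
  show ?thesis
  proof (rule ex_ex1I)
    show "\<exists>h. h \<in> ?C \<rightarrow>\<^sub>E I \<and> mono_on ?C h \<and> (\<forall>x\<in>I. h (f x) = x)"
    proof (intro exI[of _ h] conjI ballI PiE_I)
      show "h y = undefined" if "y \<notin> ?C" for y using that by (simp add: h_def)
    qed (fact hI hm hf)+
  next
    fix g k
    assume g: "g \<in> ?C \<rightarrow>\<^sub>E I \<and> mono_on ?C g \<and> (\<forall>x\<in>I. g (f x) = x)"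
      and k: "k \<in> ?C \<rightarrow>\<^sub>E I \<and> mono_on ?C k \<and> (\<forall>x\<in>I. k (f x) = x)"
    have "g y = k y" if "y \<in> ?C" for y
    proof (rule ccontr)
      assume "g y \<noteq> k y"
      then consider "g y < k y" | "k y < g y" by linarith
      then show False
      proof cases
        case 1
        then show False using g k that by (intro lt[of g k y]) (blast dest: PiE_mem)+
      next
        case 2
        then show False using g k that by (intro lt[of k g y]) (blast dest: PiE_mem)+
      qed
    qed
    then show "g = k" using g k by (blast intro: PiE_ext)
  qed
qed

end

theory Submission
  imports Defs
begin

text \<open>
  A jump of \<open>f\<close> at \<open>p\<close>, with one-sided limits \<open>L < R\<close>, is seen by the generalized inverse as a
  flat piece: it takes the value \<open>p\<close> on all of \<open>[L, R]\<close> and leaves \<open>p\<close> immediately outside. Hence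
  the mean of \<open>x\<close> can be compared with \<open>p\<close> merely by comparing \<open>f(x\<^sub>1) + \<dots> + f(x\<^sub>n)\<close> with
  \<open>n L\<close> and \<open>n R\<close> (\<open>qa_mean_le_of_right_lim\<close>, \<open>qa_mean_greater\<close> and their mirror images).

  If \<open>f\<close> is continuous, there are no flat pieces, the \<open>f\<close>-image of the mean is the arithmetic mean
  of the numbers \<open>f(x\<^sub>i)\<close> (\<open>f_qa_mean\<close>), and every property follows from the corresponding
  property of the arithmetic mean, for every \<open>n\<close>.

  If \<open>f\<close> is not continuous, it has a jump at some \<open>p\<close>, and each of the other conditions fails on
  vectors with entries close to \<open>p\<close>. Most of them fail on vectors \<open>(t, y, \<dots>, y)\<close> with \<open>y\<close> close
  to \<open>p\<close>: letting \<open>t\<close> vary on the other side of \<open>p\<close> moves the average of the values of \<open>f\<close> inside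
  \<open>[L, R]\<close> only, so the mean stays at \<open>p\<close> and is not strictly increasing (or, for \<open>t = p\<close>, not
  strict), whereas letting \<open>t\<close> cross \<open>p\<close> carries the average past \<open>R\<close> and makes the mean jump. The
  two envelopes differ on \<open>(p, y, \<dots>, y)\<close> for the same reason. A continuous \<open>g\<close> has no flat piece,
  so \<open>A\<^sub>g\<close> strictly separates from \<open>p\<close> vectors on which \<open>A\<^sub>f\<close> is stuck at \<open>p\<close> or lies on the other
  side, which rules out comparability in either direction.

  Associativity fails because \<open>A\<^sub>f(p, y) = p\<close> replaces the sum \<open>f(p) + f(y)\<close> by the different sum
  \<open>2 f(p)\<close>. The difference goes unnoticed inside \<open>[L, R]\<close>, but appending sufficiently many entries
  \<open>z\<close> with \<open>f(z)\<close> slightly above \<open>R\<close> pushes one of the two averages beyond \<open>R\<close> and leaves the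
  other one in \<open>[L, R]\<close> (\<open>sums_distinguished\<close>).
\<close>

section \<open>One-sided limits of an increasing function\<close>

text \<open>
  For increasing \<open>f\<close> these are the one-sided limits. As order-theoretic bounds they exist without any
  convergence argument and can be compared with values of \<open>f\<close> directly.
\<close>
definition left_lim :: "real set \<Rightarrow> (real \<Rightarrow> real) \<Rightarrow> real \<Rightarrow> real" where
  "left_lim I f p = (SUP t\<in>{t\<in>I. t < p}. f t)"

definition right_lim :: "real set \<Rightarrow> (real \<Rightarrow> real) \<Rightarrow> real \<Rightarrow> real" where
  "right_lim I f p = (INF t\<in>{t\<in>I. p < t}. f t)"

locale increasing_on_interval =
  fixes I :: "real set" and f :: "real \<Rightarrow> real"
  assumes open_I: "open I" and interval_I: "is_interval I" and strict_mono: "strict_mono_on I f"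
begin

lemma less: "x \<in> I \<Longrightarrow> y \<in> I \<Longrightarrow> x < y \<Longrightarrow> f x < f y"
  using strict_mono by (rule strict_mono_onD)

lemma less_eq: "x \<in> I \<Longrightarrow> y \<in> I \<Longrightarrow> x \<le> y \<Longrightarrow> f x \<le> f y"
  using less[of x y] by (cases "x = y") auto

lemma between: "a \<in> I \<Longrightarrow> b \<in> I \<Longrightarrow> a \<le> z \<Longrightarrow> z \<le> b \<Longrightarrow> z \<in> I"
  using interval_I unfolding is_interval_1 by blast

lemma neighbours:
  assumes "p \<in> I"
  obtains s t where "s \<in> I" "s < p" "t \<in> I" "p < t"
proof -
  obtain e where e: "e > 0" "cball p e \<subseteq> I"
    using open_I assms open_contains_cball by blast
  then have "p - e \<in> I" "p + e \<in> I" by (auto simp: dist_real_def)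
  with e(1) show ?thesis by (intro that[of "p - e" "p + e"]) auto
qed

lemma below_nonempty: "p \<in> I \<Longrightarrow> {t\<in>I. t < p} \<noteq> {}"
  by (erule neighbours) auto

lemma above_nonempty: "p \<in> I \<Longrightarrow> {t\<in>I. p < t} \<noteq> {}"
  by (erule neighbours) auto

lemma below_left_lim:
  assumes "p \<in> I" "t \<in> I" "t < p"
  shows "f t \<le> left_lim I f p"
  unfolding left_lim_def using assms
  by (intro cSUP_upper bdd_aboveI2[of _ _ "f p"]) (auto intro: less_eq)

lemma above_right_lim:
  assumes "p \<in> I" "t \<in> I" "p < t"
  shows "right_lim I f p \<le> f t"
  unfolding right_lim_def using assms
  by (intro cINF_lower bdd_belowI2[of _ "f p"]) (auto intro: less_eq)

lemma left_lim_le: "p \<in> I \<Longrightarrow> left_lim I f p \<le> f p"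
  unfolding left_lim_def by (intro cSUP_least below_nonempty) (auto intro: less_eq)

lemma le_right_lim: "p \<in> I \<Longrightarrow> f p \<le> right_lim I f p"
  unfolding right_lim_def by (intro cINF_greatest above_nonempty) (auto intro: less_eq)

lemma near_left:
  assumes "p \<in> I" "c < left_lim I f p"
  obtains t where "t \<in> I" "t < p" "c < f t"
proof (rule ccontr)
  assume "\<not> thesis"
  with that have "f t \<le> c" if "t \<in> I" "t < p" for t using \<open>t \<in> I\<close> \<open>t < p\<close> not_le by blast
  then have "left_lim I f p \<le> c"
    unfolding left_lim_def by (intro cSUP_least below_nonempty assms(1)) auto
  with assms(2) show False by simp
qed

lemma near_right:
  assumes "p \<in> I" "right_lim I f p < c"
  obtains t where "t \<in> I" "p < t" "f t < c"
proof (rule ccontr)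
  assume "\<not> thesis"
  with that have "c \<le> f t" if "t \<in> I" "p < t" for t using \<open>t \<in> I\<close> \<open>p < t\<close> not_le by blast
  then have "c \<le> right_lim I f p"
    unfolding right_lim_def by (intro cINF_greatest above_nonempty assms(1)) auto
  with assms(2) show False by simp
qed

lemma right_lim_less:
  assumes "p \<in> I" "t \<in> I" "p < t"
  shows "right_lim I f p < f t"
proof -
  obtain m where m: "p < m" "m < t" using assms(3) dense by blast
  then have "m \<in> I" using between[of p t m] assms by simp
  then have "right_lim I f p \<le> f m" "f m < f t" using m assms above_right_lim less by auto
  then show ?thesis by simp
qed

lemma left_lim_less:
  assumes "p \<in> I" "t \<in> I" "t < p"
  shows "f t < left_lim I f p"
proof -
  obtain m where m: "t < m" "m < p" using assms(3) dense by blast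
  then have "m \<in> I" using between[of t p m] assms by simp
  then have "f m \<le> left_lim I f p" "f t < f m" using m assms below_left_lim less by auto
  then show ?thesis by simp
qed

text \<open>
  For small \<open>r\<close>, the infimum of \<open>f\<close> over \<open>(p - r, p + r)\<close> is squeezed between the value of \<open>f\<close> at a
  point below \<open>p - r\<close>, which can be chosen so that this value is close to the left limit, and the left
  limit itself.
\<close>
lemma lower_env_eq_left_lim:
  assumes p: "p \<in> I"
  shows "lower_env I f p = left_lim I f p"
  unfolding lower_env_def
proof (rule tendsto_Lim)
  let ?g = "\<lambda>r. INF u\<in>{p - r<..<p + r} \<inter> I. f u"
  show "(?g \<longlongrightarrow> left_lim I f p) (at_right 0)"
  proof (rule order_tendstoI)
    fix c assume "c < left_lim I f p"
    then obtain d where d: "c < d" "d < left_lim I f p" using dense by blast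
    obtain t where t: "t \<in> I" "t < p" "d < f t" using near_left[OF p d(2)] .
    have "c < ?g r" if r: "0 < r" "r < p - t" for r
    proof -
      have "d \<le> ?g r"
      proof (rule cINF_greatest)
        show "{p - r<..<p + r} \<inter> I \<noteq> {}" using p r by force
        show "d \<le> f u" if "u \<in> {p - r<..<p + r} \<inter> I" for u
          using less_eq[of t u] t that r by auto
      qed
      with d show ?thesis by simp
    qed
    then show "\<forall>\<^sub>F r in at_right 0. c < ?g r"
      unfolding eventually_at_right_field using t(2) by (intro exI[of _ "p - t"]) auto
  next
    fix c assume c: "left_lim I f p < c"
    obtain t where t: "t \<in> I" "t < p" using neighbours[OF p] .
    have "?g r < c" if r: "0 < r" "r < p - t" for r
    proof -
      have u: "p - r/2 \<in> I" using between[OF t(1) p] r by simp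
      have "?g r \<le> f (p - r/2)"
      proof (rule cINF_lower)
        show "bdd_below (f ` ({p - r<..<p + r} \<inter> I))"
          using t r by (intro bdd_belowI2[of _ "f t"] less_eq) auto
        show "p - r/2 \<in> {p - r<..<p + r} \<inter> I" using u r by simp
      qed
      also have "\<dots> \<le> left_lim I f p" using u p r by (intro below_left_lim) auto
      finally show ?thesis using c by simp
    qed
    then show "\<forall>\<^sub>F r in at_right 0. ?g r < c"
      unfolding eventually_at_right_field using t(2) by (intro exI[of _ "p - t"]) auto
  qed
qed simp

lemma upper_env_eq_right_lim:
  assumes p: "p \<in> I"
  shows "upper_env I f p = right_lim I f p"
  unfolding upper_env_def
proof (rule tendsto_Lim)
  let ?g = "\<lambda>r. SUP u\<in>{p - r<..<p + r} \<inter> I. f u"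
  show "(?g \<longlongrightarrow> right_lim I f p) (at_right 0)"
  proof (rule order_tendstoI)
    fix c assume "right_lim I f p < c"
    then obtain d where d: "right_lim I f p < d" "d < c" using dense by blast
    obtain t where t: "t \<in> I" "p < t" "f t < d" using near_right[OF p d(1)] .
    have "?g r < c" if r: "0 < r" "r < t - p" for r
    proof -
      have "?g r \<le> d"
      proof (rule cSUP_least)
        show "{p - r<..<p + r} \<inter> I \<noteq> {}" using p r by force
        show "f u \<le> d" if "u \<in> {p - r<..<p + r} \<inter> I" for u
          using less_eq[of u t] t that r by auto
      qed
      with d show ?thesis by simp
    qed
    then show "\<forall>\<^sub>F r in at_right 0. ?g r < c"
      unfolding eventually_at_right_field using t(2) by (intro exI[of _ "t - p"]) auto
  next
    fix c assume c: "c < right_lim I f p"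
    obtain t where t: "t \<in> I" "p < t" using neighbours[OF p] .
    have "c < ?g r" if r: "0 < r" "r < t - p" for r
    proof -
      have u: "p + r/2 \<in> I" using between[OF p t(1)] r by simp
      have "right_lim I f p \<le> f (p + r/2)" using u p r by (intro above_right_lim) auto
      also have "f (p + r/2) \<le> ?g r"
      proof (rule cSUP_upper)
        show "bdd_above (f ` ({p - r<..<p + r} \<inter> I))"
          using t r by (intro bdd_aboveI2[of _ _ "f t"] less_eq) auto
        show "p + r/2 \<in> {p - r<..<p + r} \<inter> I" using u r by simp
      qed
      finally show ?thesis using c by simp
    qed
    then show "\<forall>\<^sub>F r in at_right 0. c < ?g r"
      unfolding eventually_at_right_field using t(2) by (intro exI[of _ "t - p"]) auto
  qed
qed simp

text \<open>
  If the one-sided limits agree at \<open>p\<close>, both are equal to \<open>f p\<close>, and monotonicity traps \<open>f\<close> near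
  \<open>p\<close> between two values that are close to \<open>f p\<close>.
\<close>
lemma discontinuous_imp_jump:
  assumes "\<not> continuous_on I f"
  obtains p where "p \<in> I" "left_lim I f p < right_lim I f p"
proof -
  have "\<exists>p\<in>I. left_lim I f p < right_lim I f p"
  proof (rule ccontr)
    assume nojump: "\<not> ?thesis"
    have "(f \<longlongrightarrow> f p) (at p)" if p: "p \<in> I" for p
    proof -
      have eq: "left_lim I f p = f p" "right_lim I f p = f p"
        using nojump p left_lim_le[OF p] le_right_lim[OF p] by force+
      show ?thesis
      proof (rule order_tendstoI)
        fix c assume "c < f p"
        then obtain s where s: "s \<in> I" "s < p" "c < f s" using near_left[OF p, of c] eq by auto
        have "\<forall>\<^sub>F u in at p. u \<in> I \<inter> {s<..}"
          using open_I s p by (intro eventually_at_in_open') auto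
        then show "\<forall>\<^sub>F u in at p. c < f u"
          by eventually_elim (use s less in force)
      next
        fix c assume "f p < c"
        then obtain t where t: "t \<in> I" "p < t" "f t < c" using near_right[OF p, of c] eq by auto
        have "\<forall>\<^sub>F u in at p. u \<in> I \<inter> {..<t}"
          using open_I t p by (intro eventually_at_in_open') auto
        then show "\<forall>\<^sub>F u in at p. f u < c"
          by eventually_elim (use t less in force)
      qed
    qed
    then have "continuous_on I f"
      using open_I by (simp add: continuous_on_eq_continuous_at isCont_def)
    with assms show False by simp
  qed
  with that show ?thesis by blast
qed

lemma continuous_imp_limits_eq:
  assumes cont: "continuous_on I f" and p: "p \<in> I"
  shows "left_lim I f p = f p" "right_lim I f p = f p"
proof -
  have lim: "(f \<longlongrightarrow> f p) (at p)"
    using cont open_I p by (simp add: continuous_on_eq_continuous_at isCont_def)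
  have left: "(f \<longlongrightarrow> f p) (at_left p)" and right: "(f \<longlongrightarrow> f p) (at_right p)"
    using lim by (auto simp: filterlim_at_split)
  obtain s t where st: "s \<in> I" "s < p" "t \<in> I" "p < t" using neighbours[OF p] .
  have "\<forall>\<^sub>F u in at_left p. f u \<le> left_lim I f p"
    unfolding eventually_at_left_field
    using st p between[of s p] by (intro exI[of _ s]) (auto intro!: below_left_lim)
  then have "f p \<le> left_lim I f p" by (intro tendsto_upperbound[OF left]) auto
  with left_lim_le[OF p] show "left_lim I f p = f p" by simp
  have "\<forall>\<^sub>F u in at_right p. right_lim I f p \<le> f u"
    unfolding eventually_at_right_field
    using st p between[of p t] by (intro exI[of _ t]) (auto intro!: above_right_lim)
  then have "right_lim I f p \<le> f p" by (intro tendsto_lowerbound[OF right]) auto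
  with le_right_lim[OF p] show "right_lim I f p = f p" by simp
qed

section \<open>Locating a generalized quasiarithmetic mean\<close>

abbreviation C where "C \<equiv> convex hull (f ` I)"
abbreviation h where "h \<equiv> gen_inverse I f"

lemma gen_inverse_props:
  "h \<in> C \<rightarrow>\<^sub>E I" "mono_on C h" "x \<in> I \<Longrightarrow> h (f x) = x"
  using theI'[OF gen_inverse_ex1[OF interval_I strict_mono]]
  unfolding gen_inverse_def[symmetric] by auto

lemma mean_in_hull:
  assumes "n \<ge> 1" "x \<in> {1..n} \<rightarrow>\<^sub>E I"
  shows "(\<Sum>i=1..n. f (x i)) / real n \<in> C"
proof -
  have "(\<Sum>i=1..n. (1 / real n) *\<^sub>R f (x i)) \<in> C"
    using assms by (intro convex_sum hull_inc) auto
  then show ?thesis by (simp add: sum_divide_distrib)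
qed

lemma qa_mean_in:
  assumes "n \<ge> 1" "x \<in> {1..n} \<rightarrow>\<^sub>E I"
  shows "qa_mean I f n x \<in> I"
  unfolding qa_mean_def using gen_inverse_props(1) mean_in_hull[OF assms] by (rule PiE_mem)

lemma qa_mean_le:
  assumes "n \<ge> 1" "x \<in> {1..n} \<rightarrow>\<^sub>E I" "s \<in> I" "(\<Sum>i=1..n. f (x i)) \<le> real n * f s"
  shows "qa_mean I f n x \<le> s"
proof -
  have "(\<Sum>i=1..n. f (x i)) / real n \<le> f s" using assms by (simp add: field_simps)
  then have "qa_mean I f n x \<le> h (f s)"
    unfolding qa_mean_def using assms
    by (intro mono_onD[OF gen_inverse_props(2)] mean_in_hull hull_inc) auto
  with assms gen_inverse_props(3) show ?thesis by simp
qed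

lemma qa_mean_ge:
  assumes "n \<ge> 1" "x \<in> {1..n} \<rightarrow>\<^sub>E I" "s \<in> I" "real n * f s \<le> (\<Sum>i=1..n. f (x i))"
  shows "s \<le> qa_mean I f n x"
proof -
  have "f s \<le> (\<Sum>i=1..n. f (x i)) / real n" using assms by (simp add: field_simps)
  then have "h (f s) \<le> qa_mean I f n x"
    unfolding qa_mean_def using assms
    by (intro mono_onD[OF gen_inverse_props(2)] mean_in_hull hull_inc) auto
  with assms gen_inverse_props(3) show ?thesis by simp
qed

text \<open>
  The four lemmas from here on express that the generalized inverse is constantly \<open>p\<close> between the
  one-sided limits at \<open>p\<close> and differs from \<open>p\<close> elsewhere. All later estimates go through them, so that
  the generalized inverse itself need not be mentioned again.
\<close>
lemma qa_mean_le_of_right_lim: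
  assumes n: "n \<ge> 1" and x: "x \<in> {1..n} \<rightarrow>\<^sub>E I" and p: "p \<in> I"
    and sum: "(\<Sum>i=1..n. f (x i)) \<le> real n * right_lim I f p"
  shows "qa_mean I f n x \<le> p"
proof (rule ccontr)
  assume "\<not> ?thesis"
  then obtain t where t: "p < t" "t < qa_mean I f n x" using dense not_le by blast
  have tI: "t \<in> I" using between[OF p qa_mean_in[OF n x]] t by simp
  have "real n * right_lim I f p \<le> real n * f t"
    using above_right_lim[OF p tI] t by (intro mult_left_mono) auto
  with sum have "qa_mean I f n x \<le> t" by (intro qa_mean_le[OF n x tI]) simp
  with t show False by simp
qed

lemma qa_mean_ge_of_left_lim:
  assumes n: "n \<ge> 1" and x: "x \<in> {1..n} \<rightarrow>\<^sub>E I" and p: "p \<in> I"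
    and sum: "real n * left_lim I f p \<le> (\<Sum>i=1..n. f (x i))"
  shows "p \<le> qa_mean I f n x"
proof (rule ccontr)
  assume "\<not> ?thesis"
  then obtain t where t: "qa_mean I f n x < t" "t < p" using dense not_le by blast
  have tI: "t \<in> I" using between[OF qa_mean_in[OF n x] p] t by simp
  have "real n * f t \<le> real n * left_lim I f p"
    using below_left_lim[OF p tI] t by (intro mult_left_mono) auto
  with sum have "t \<le> qa_mean I f n x" by (intro qa_mean_ge[OF n x tI]) simp
  with t show False by simp
qed

lemma qa_mean_greater:
  assumes n: "n \<ge> 1" and x: "x \<in> {1..n} \<rightarrow>\<^sub>E I" and p: "p \<in> I"
    and sum: "real n * right_lim I f p < (\<Sum>i=1..n. f (x i))"
  shows "p < qa_mean I f n x"
proof -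
  have "right_lim I f p < (\<Sum>i=1..n. f (x i)) / real n" using n sum by (simp add: field_simps)
  then obtain s where s: "s \<in> I" "p < s" "f s < (\<Sum>i=1..n. f (x i)) / real n"
    using near_right[OF p] by blast
  then have "s \<le> qa_mean I f n x" using n by (intro qa_mean_ge[OF n x]) (auto simp: field_simps)
  with s show ?thesis by simp
qed

lemma qa_mean_less:
  assumes n: "n \<ge> 1" and x: "x \<in> {1..n} \<rightarrow>\<^sub>E I" and p: "p \<in> I"
    and sum: "(\<Sum>i=1..n. f (x i)) < real n * left_lim I f p"
  shows "qa_mean I f n x < p"
proof -
  have "(\<Sum>i=1..n. f (x i)) / real n < left_lim I f p" using n sum by (simp add: field_simps)
  then obtain s where s: "s \<in> I" "s < p" "(\<Sum>i=1..n. f (x i)) / real n < f s"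
    using near_left[OF p] by blast
  then have "qa_mean I f n x \<le> s" using n by (intro qa_mean_le[OF n x]) (auto simp: field_simps)
  with s show ?thesis by simp
qed

end

section \<open>Test vectors\<close>

definition padded :: "nat \<Rightarrow> nat \<Rightarrow> (nat \<Rightarrow> real) \<Rightarrow> real \<Rightarrow> nat \<Rightarrow> real" where
  "padded n k u z = (\<lambda>i\<in>{1..n}. if i \<le> k then u i else z)"

lemma padded_in: "\<lbrakk>\<And>i. i \<in> {1..k} \<Longrightarrow> u i \<in> I; z \<in> I\<rbrakk> \<Longrightarrow> padded n k u z \<in> {1..n} \<rightarrow>\<^sub>E I"
  by (auto simp: padded_def)

lemma sum_padded:
  assumes "k \<le> n"
  shows "(\<Sum>i=1..n. f (padded n k u z i)) = (\<Sum>i=1..k. f (u i)) + (real n - real k) * f z"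
proof -
  have split: "{1..n} = {1..k} \<union> {k+1..n}" using assms by auto
  have "(\<Sum>i=1..n. f (padded n k u z i))
      = (\<Sum>i=1..k. f (padded n k u z i)) + (\<Sum>i=k+1..n. f (padded n k u z i))"
    unfolding split by (rule sum.union_disjoint) auto
  also have "(\<Sum>i=1..k. f (padded n k u z i)) = (\<Sum>i=1..k. f (u i))"
    using assms by (intro sum.cong) (auto simp: padded_def)
  also have "(\<Sum>i=k+1..n. f (padded n k u z i)) = (\<Sum>i=k+1..n. f z)"
    by (intro sum.cong) (auto simp: padded_def)
  finally show ?thesis using assms by (simp add: of_nat_diff)
qed

abbreviation odd_one_out :: "nat \<Rightarrow> real \<Rightarrow> real \<Rightarrow> nat \<Rightarrow> real" where
  "odd_one_out n t y \<equiv> padded n 1 (\<lambda>_. t) y"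

lemma odd_one_out_in: "t \<in> I \<Longrightarrow> y \<in> I \<Longrightarrow> odd_one_out n t y \<in> {1..n} \<rightarrow>\<^sub>E I"
  by (rule padded_in)

text \<open>
  Here and below, \<open>1\<close> is unfolded to \<open>Suc 0\<close> because this is the form to which the simplifier brings
  the goals that these equations are to rewrite.
\<close>
lemma sum_odd_one_out [unfolded One_nat_def]:
  "n \<ge> 2 \<Longrightarrow> (\<Sum>i=1..n. f (odd_one_out n t y i)) = f t + (real n - 1) * f y"
  by (subst sum_padded) auto

lemma odd_one_out_upd [unfolded One_nat_def]: "n \<ge> 1 \<Longrightarrow> (odd_one_out n t y)(1 := s) = odd_one_out n s y"
  by (auto simp: padded_def fun_eq_iff)

lemma image_odd_one_out:
  assumes "n \<ge> 2"
  shows "odd_one_out n t y ` {1..n} = {t, y}"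
proof
  show "odd_one_out n t y ` {1..n} \<subseteq> {t, y}" by (auto simp: padded_def)
  have "t \<in> odd_one_out n t y ` {1..n}"
    by (rule image_eqI[of _ _ 1]) (use assms in \<open>auto simp: padded_def\<close>)
  moreover have "y \<in> odd_one_out n t y ` {1..n}"
    by (rule image_eqI[of _ _ 2]) (use assms in \<open>auto simp: padded_def\<close>)
  ultimately show "{t, y} \<subseteq> odd_one_out n t y ` {1..n}" by simp
qed

text \<open>
  How close to \<open>b\<close> the \<open>n - 1\<close> equal values \<open>v\<close> have to be so that a single smaller value \<open>a\<close> still
  pulls their average below \<open>b\<close>.
\<close>
lemma weighted_less:
  assumes "n \<ge> 2" "a < b" "v < b + (b - a) / real n"
  shows "a + (real n - 1) * v < real n * b"
proof -
  have "(real n - 1) * v \<le> (real n - 1) * (b + (b - a) / real n)"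
    using assms by (intro mult_left_mono) auto
  also have "\<dots> = real n * b - a - (b - a) / real n" using assms by (simp add: field_simps)
  finally show ?thesis using divide_pos_pos[of "b - a" "real n"] assms(1,2) by linarith
qed

lemma weighted_greater:
  assumes "n \<ge> 2" "a > b" "v > b - (a - b) / real n"
  shows "a + (real n - 1) * v > real n * b"
  using weighted_less[of n "- a" "- b" "- v"] assms by (simp add: algebra_simps)

section \<open>Consequences of a jump\<close>

locale jump = increasing_on_interval +
  fixes p :: real
  assumes p: "p \<in> I" and jump: "left_lim I f p < right_lim I f p"
begin

abbreviation L where "L \<equiv> left_lim I f p"
abbreviation R where "R \<equiv> right_lim I f p"

lemma below:
  assumes "e > 0" obtains t where "t \<in> I" "t < p" "L - e < f t" "f t < L"
  using near_left[OF p, of "L - e"] left_lim_less[OF p] assms by auto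

lemma above:
  assumes "e > 0" obtains t where "t \<in> I" "p < t" "R < f t" "f t < R + e"
  using near_right[OF p, of "R + e"] right_lim_less[OF p] assms by auto

lemma gap_div: "n \<ge> 2 \<Longrightarrow> (R - L) / real n > 0"
  using jump by simp

text \<open>
  On \<open>(t, y, \<dots>, y)\<close> with \<open>t\<close> just below \<open>p\<close> and \<open>y > p\<close>, the jump of \<open>f\<close> compensates the deficit of
  \<open>f t\<close> however close \<open>y\<close> is to \<open>p\<close>, so \<open>A\<^sub>f \<ge> p\<close>. A continuous \<open>g\<close> offers no such compensation:
  after fixing \<open>t\<close>, a choice of \<open>y\<close> sufficiently close to \<open>p\<close> yields \<open>A\<^sub>g < p\<close>. The mirror image refutes
  the other inequality.
\<close>
lemma not_comparable:
  assumes n: "n \<ge> 2"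
  shows "\<not> comparable_continuous_qa I f n"
proof
  assume "comparable_continuous_qa I f n"
  then obtain g where g: "continuous_on I g" "strict_mono_on I g"
    and cmp: "(\<forall>x \<in> {1..n} \<rightarrow>\<^sub>E I. qa_mean I f n x \<le> qa_mean I g n x) \<or>
              (\<forall>x \<in> {1..n} \<rightarrow>\<^sub>E I. qa_mean I g n x \<le> qa_mean I f n x)"
    unfolding comparable_continuous_qa_def by blast
  interpret g: increasing_on_interval I g
    using open_I interval_I g(2) by unfold_locales
  note glim = g.continuous_imp_limits_eq[OF g(1) p]
  from cmp show False
  proof
    assume le: "\<forall>x \<in> {1..n} \<rightarrow>\<^sub>E I. qa_mean I f n x \<le> qa_mean I g n x"
    obtain t where t: "t \<in> I" "t < p" "L - (R - L) < f t"
      using below[of "R - L"] jump by auto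
    have gt: "g t < g p" using g.less t p by simp
    obtain y where y: "y \<in> I" "p < y" "g y < g p + (g p - g t) / real n"
      using g.near_right[OF p, of "g p + (g p - g t) / real n"] glim gt n by auto
    let ?x = "odd_one_out n t y"
    have x: "?x \<in> {1..n} \<rightarrow>\<^sub>E I" using t y by (intro odd_one_out_in)
    have "qa_mean I g n ?x < p"
      using weighted_less[OF n gt y(3)] n glim
      by (intro g.qa_mean_less x p) (auto simp: sum_odd_one_out)
    moreover have "p \<le> qa_mean I f n ?x"
    proof (rule qa_mean_ge_of_left_lim[OF _ x p])
      have "(real n - 1) * R \<le> (real n - 1) * f y"
        using n y above_right_lim[OF p] by (intro mult_left_mono) auto
      moreover have "(real n - 2) * L \<le> (real n - 2) * R"
        using n jump by (intro mult_left_mono) auto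
      ultimately show "real n * L \<le> (\<Sum>i=1..n. f (?x i))"
        using t n by (simp add: sum_odd_one_out algebra_simps)
    qed (use n in simp)
    ultimately show False using le x by force
  next
    assume le: "\<forall>x \<in> {1..n} \<rightarrow>\<^sub>E I. qa_mean I g n x \<le> qa_mean I f n x"
    obtain t where t: "t \<in> I" "p < t" "f t < R + (R - L)"
      using above[of "R - L"] jump by auto
    have gt: "g p < g t" using g.less t p by simp
    obtain y where y: "y \<in> I" "y < p" "g p - (g t - g p) / real n < g y"
      using g.near_left[OF p, of "g p - (g t - g p) / real n"] glim gt n by auto
    let ?x = "odd_one_out n t y"
    have x: "?x \<in> {1..n} \<rightarrow>\<^sub>E I" using t y by (intro odd_one_out_in)
    have "p < qa_mean I g n ?x"
      using weighted_greater[OF n gt y(3)] n glim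
      by (intro g.qa_mean_greater x p) (auto simp: sum_odd_one_out)
    moreover have "qa_mean I f n ?x \<le> p"
    proof (rule qa_mean_le_of_right_lim[OF _ x p])
      have "(real n - 1) * f y \<le> (real n - 1) * L"
        using n y below_left_lim[OF p] by (intro mult_left_mono) auto
      moreover have "(real n - 2) * L \<le> (real n - 2) * R"
        using n jump by (intro mult_left_mono) auto
      ultimately show "(\<Sum>i=1..n. f (?x i)) \<le> real n * R"
        using t n by (simp add: sum_odd_one_out algebra_simps)
    qed (use n in simp)
    ultimately show False using le x by force
  qed
qed

text \<open>
  Fix \<open>y > p\<close> with \<open>f y\<close> close to \<open>R\<close> and let \<open>t\<close> run through \<open>I\<close>. The mean of \<open>(t, y, \<dots>, y)\<close> is
  at most \<open>p\<close> for \<open>t < p\<close> and at least some fixed \<open>s > p\<close> for \<open>t > p\<close>. Were it continuous in \<open>t\<close>, it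
  would attain every value in \<open>(p, s)\<close>, and all of them could only be attained at \<open>t = p\<close>.
\<close>
lemma not_continuous:
  assumes n: "n \<ge> 2"
  shows "\<not> continuous_on ({1..n} \<rightarrow>\<^sub>E I) (qa_mean I f n)"
proof
  assume cont: "continuous_on ({1..n} \<rightarrow>\<^sub>E I) (qa_mean I f n)"
  obtain y where y: "y \<in> I" "p < y" "R < f y" "f y < R + (R - L) / real n"
    using above[OF gap_div[OF n]] .
  let ?m = "(R + (real n - 1) * f y) / real n"
  have "(real n - 1) * R < (real n - 1) * f y" using n y by (intro mult_strict_left_mono) auto
  then have "R < ?m" using n by (simp add: field_simps)
  then obtain s where s: "s \<in> I" "p < s" "f s < ?m" using near_right[OF p] by blast
  define \<phi> where "\<phi> t = qa_mean I f n (odd_one_out n t y)" for t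
  have left: "\<phi> t \<le> p" if "t \<in> I" "t < p" for t
    unfolding \<phi>_def
  proof (rule qa_mean_le_of_right_lim)
    show "(\<Sum>i=1..n. f (odd_one_out n t y i)) \<le> real n * R"
      using weighted_less[OF n jump y(4)] below_left_lim[OF p that] n
      by (simp add: sum_odd_one_out)
  qed (use n that y p odd_one_out_in in auto)
  have right: "s \<le> \<phi> t" if "t \<in> I" "p < t" for t
    unfolding \<phi>_def
  proof (rule qa_mean_ge)
    show "real n * f s \<le> (\<Sum>i=1..n. f (odd_one_out n t y i))"
      using s(3) above_right_lim[OF p that] n by (simp add: sum_odd_one_out field_simps)
  qed (use n that y s odd_one_out_in in auto)
  have "continuous_on I \<phi>"
    unfolding \<phi>_def
  proof (rule continuous_on_compose2[OF cont])
    show "continuous_on I (\<lambda>t. odd_one_out n t y)"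
    proof (rule continuous_on_coordinatewise_then_product)
      show "continuous_on I (\<lambda>t. odd_one_out n t y i)" for i
        unfolding padded_def restrict_def
        by (cases "i \<in> {1..n}"; cases "i \<le> 1")
           (simp_all only: if_True if_False continuous_on_id continuous_on_const)
    qed
  qed (use y odd_one_out_in in blast)
  then have img: "is_interval (\<phi> ` I)"
    using interval_I by (simp add: is_interval_connected_1 connected_continuous_image)
  obtain t1 t2 where t12: "t1 \<in> I" "t1 < p" "t2 \<in> I" "p < t2" using neighbours[OF p] .
  have hit: "\<phi> p = q" if q: "p < q" "q < s" for q
  proof -
    have "q \<in> \<phi> ` I"
      using img left[OF t12(1,2)] right[OF t12(3,4)] t12 q unfolding is_interval_1
      by (meson imageI less_imp_le order_trans)
    then obtain t where t: "t \<in> I" "\<phi> t = q" by blast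
    then have "t = p" using left[of t] right[of t] q by (cases t p rule: linorder_cases) auto
    with t show ?thesis by simp
  qed
  \<comment> \<open>Two different intermediate values at the same point.\<close>
  show False
    using hit[of "(2 * p + s) / 3"] hit[of "(p + 2 * s) / 3"] s(2) by simp
qed

text \<open>
  On \<open>(p, y, \<dots>, y)\<close> with \<open>y\<close> just above \<open>p\<close>, the upper envelope contributes \<open>R\<close> at \<open>p\<close> and more
  than \<open>R\<close> elsewhere, which puts its mean above \<open>p\<close>. The lower envelope contributes only \<open>L\<close> at \<open>p\<close>, and
  this keeps its mean at \<open>p\<close> or below.
\<close>
lemma not_envelopes_le:
  assumes n: "n \<ge> 2"
  shows "\<not> (\<forall>x \<in> {1..n} \<rightarrow>\<^sub>E I. qa_mean I (upper_env I f) n x \<le> qa_mean I (lower_env I f) n x)"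
proof
  assume le: "\<forall>x \<in> {1..n} \<rightarrow>\<^sub>E I. qa_mean I (upper_env I f) n x \<le> qa_mean I (lower_env I f) n x"
  have "strict_mono_on I (upper_env I f)"
  proof (rule strict_mono_onI)
    fix r s assume "r \<in> I" "s \<in> I" "r < s"
    then show "upper_env I f r < upper_env I f s"
      using right_lim_less[of r s] le_right_lim[of s] by (simp add: upper_env_eq_right_lim)
  qed
  then interpret u: increasing_on_interval I "upper_env I f"
    using open_I interval_I by unfold_locales
  have "strict_mono_on I (lower_env I f)"
  proof (rule strict_mono_onI)
    fix r s assume "r \<in> I" "s \<in> I" "r < s"
    then show "lower_env I f r < lower_env I f s"
      using left_lim_less[of s r] left_lim_le[of r] by (simp add: lower_env_eq_left_lim)
  qed
  then interpret l: increasing_on_interval I "lower_env I f"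
    using open_I interval_I by unfold_locales
  obtain y where y: "y \<in> I" "p < y" "R < f y" "f y < R + (R - L) / real n"
    using above[OF gap_div[OF n]] .
  let ?x = "odd_one_out n p y"
  have x: "?x \<in> {1..n} \<rightarrow>\<^sub>E I" using p y by (intro odd_one_out_in)
  have "qa_mean I (lower_env I f) n ?x \<le> p"
  proof (rule l.qa_mean_le_of_right_lim[OF _ x p])
    have "R \<le> right_lim I (lower_env I f) p"
    proof -
      obtain t where "t \<in> I" "p < t" using neighbours[OF p] .
      moreover have "R \<le> lower_env I f t" if t: "t \<in> I" "p < t" for t
      proof -
        obtain m where m: "p < m" "m < t" using t(2) dense by blast
        then have "m \<in> I" using between[OF p t(1)] by simp
        then show ?thesis
          using above_right_lim[OF p _ m(1)] below_left_lim[OF t(1) _ m(2)] t(1)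
          by (simp add: lower_env_eq_left_lim)
      qed
      ultimately show ?thesis
        unfolding right_lim_def[of I "lower_env I f"] by (intro cINF_greatest) auto
    qed
    then have "real n * R \<le> real n * right_lim I (lower_env I f) p" by (intro mult_left_mono) auto
    moreover have "(real n - 1) * left_lim I f y \<le> (real n - 1) * f y"
      using n left_lim_le[OF y(1)] by (intro mult_left_mono) auto
    ultimately have "L + (real n - 1) * left_lim I f y \<le> real n * right_lim I (lower_env I f) p"
      using weighted_less[OF n jump y(4)] by linarith
    then show "(\<Sum>i=1..n. lower_env I f (?x i)) \<le> real n * right_lim I (lower_env I f) p"
      using n p y(1) by (simp add: sum_odd_one_out lower_env_eq_left_lim)
  qed (use n in simp)
  moreover have "p < qa_mean I (upper_env I f) n ?x"
  proof -
    have "(real n - 1) * R < (real n - 1) * right_lim I f y"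
      using n y le_right_lim[OF y(1)] by (intro mult_strict_left_mono) auto
    then have "R < (R + (real n - 1) * right_lim I f y) / real n" using n by (simp add: field_simps)
    then obtain t where t: "t \<in> I" "p < t" "f t < (R + (real n - 1) * right_lim I f y) / real n"
      using near_right[OF p] by blast
    obtain s where s: "p < s" "s < t" using t(2) dense by blast
    then have sI: "s \<in> I" using between[OF p t(1)] by simp
    have "upper_env I f s \<le> f t"
      using above_right_lim[OF sI t(1) s(2)] sI by (simp add: upper_env_eq_right_lim)
    then have "real n * upper_env I f s \<le> real n * f t" by (intro mult_left_mono) auto
    moreover have "real n * f t < R + (real n - 1) * right_lim I f y"
      using t(3) n by (simp add: field_simps)
    ultimately have "real n * upper_env I f s \<le> R + (real n - 1) * right_lim I f y" by linarith
    then have "s \<le> qa_mean I (upper_env I f) n ?x"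
      using n p y(1)
      by (intro u.qa_mean_ge x sI) (simp_all add: sum_odd_one_out upper_env_eq_right_lim)
    with s show ?thesis by simp
  qed
  ultimately show False using le x by force
qed

text \<open>
  With \<open>y\<close> just above \<open>p\<close>, all vectors \<open>(t, y, \<dots>, y)\<close> with \<open>t\<close> just below \<open>p\<close> have the same mean \<open>p\<close>.
\<close>
lemma not_strict_mono_each_var:
  assumes n: "n \<ge> 2"
  shows "\<not> strict_mono_each_var I n (qa_mean I f n)"
proof
  assume sm: "strict_mono_each_var I n (qa_mean I f n)"
  obtain y where y: "y \<in> I" "p < y" "R < f y" "f y < R + (R - L) / real n"
    using above[OF gap_div[OF n]] .
  obtain t1 where t1: "t1 \<in> I" "t1 < p" "L - (R - L) < f t1"
    using below[of "R - L"] jump by auto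
  obtain t2 where t2: "t1 < t2" "t2 < p" using t1(2) dense by blast
  have t2I: "t2 \<in> I" using between[OF t1(1) p] t2 by simp
  have mean: "qa_mean I f n (odd_one_out n t y) = p" if t: "t \<in> I" "t1 \<le> t" "t < p" for t
  proof (rule antisym)
    have x: "odd_one_out n t y \<in> {1..n} \<rightarrow>\<^sub>E I" using t y by (intro odd_one_out_in)
    have "f t + (real n - 1) * f y \<le> real n * R"
      using weighted_less[OF n jump y(4)] below_left_lim[OF p t(1,3)] by simp
    then show "qa_mean I f n (odd_one_out n t y) \<le> p"
      using n by (intro qa_mean_le_of_right_lim x p) (auto simp: sum_odd_one_out)
    have "(real n - 1) * R \<le> (real n - 1) * f y" using n y by (intro mult_left_mono) auto
    moreover have "(real n - 2) * L \<le> (real n - 2) * R"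
      using n jump by (intro mult_left_mono) auto
    moreover have "f t1 \<le> f t" using less_eq t t1 by simp
    ultimately have "real n * L \<le> f t + (real n - 1) * f y"
      using t1(3) by (simp add: algebra_simps)
    then show "p \<le> qa_mean I f n (odd_one_out n t y)"
      using n by (intro qa_mean_ge_of_left_lim x p) (auto simp: sum_odd_one_out)
  qed
  have "odd_one_out n p y \<in> {1..n} \<rightarrow>\<^sub>E I" using p y(1) by (rule odd_one_out_in)
  moreover have "1 \<in> {1..n}" using n by simp
  ultimately have "strict_mono_on I (\<lambda>t. qa_mean I f n ((odd_one_out n p y)(1 := t)))"
    using sm unfolding strict_mono_each_var_def by blast
  then have "strict_mono_on I (\<lambda>t. qa_mean I f n (odd_one_out n t y))"
    using n by (simp add: odd_one_out_upd)
  then have "qa_mean I f n (odd_one_out n t1 y) < qa_mean I f n (odd_one_out n t2 y)"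
    using t1(1) t2I t2(1) by (rule strict_mono_onD)
  with mean[OF t1(1)] mean[OF t2I] t1 t2 show False by simp
qed

text \<open>
  Since \<open>L < R\<close>, the value \<open>f p\<close> is less than \<open>R\<close> or greater than \<open>L\<close>. On the side where there is room,
  a point \<open>y\<close> close to \<open>p\<close> does not push the average of \<open>(p, y, \<dots>, y)\<close> out of \<open>[L, R]\<close>.
\<close>
lemma absorbing_neighbour:
  assumes n: "n \<ge> 2"
  obtains y where "y \<in> I" "y \<noteq> p" "qa_mean I f n (odd_one_out n p y) = p"
    "real n * L \<le> f p + (real n - 1) * f y" "f p + (real n - 1) * f y \<le> real n * R"
proof -
  have mean: "qa_mean I f n (odd_one_out n p y) = p"
    if "y \<in> I" "real n * L \<le> f p + (real n - 1) * f y" "f p + (real n - 1) * f y \<le> real n * R" for y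
    using that n p
    by (intro antisym qa_mean_le_of_right_lim qa_mean_ge_of_left_lim odd_one_out_in)
       (auto simp: sum_odd_one_out)
  consider "f p < R" | "L < f p" using jump by linarith
  then show ?thesis
  proof cases
    case 1
    then have "(R - f p) / real n > 0" using n by simp
    then obtain y where y: "y \<in> I" "p < y" "R < f y" "f y < R + (R - f p) / real n"
      using above by blast
    have "(real n - 1) * L \<le> (real n - 1) * f y"
      using n y jump by (intro mult_left_mono) auto
    then have "real n * L \<le> f p + (real n - 1) * f y"
      using left_lim_le[OF p] by (simp add: algebra_simps)
    moreover have "f p + (real n - 1) * f y \<le> real n * R"
      using weighted_less[OF n 1 y(4)] by simp
    ultimately show ?thesis using that[of y] mean[of y] y by simp
  next
    case 2
    then have "(f p - L) / real n > 0" using n by simp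
    then obtain y where y: "y \<in> I" "y < p" "L - (f p - L) / real n < f y" "f y < L"
      using below by blast
    have "(real n - 1) * f y \<le> (real n - 1) * R"
      using n y jump by (intro mult_left_mono) auto
    then have "f p + (real n - 1) * f y \<le> real n * R"
      using le_right_lim[OF p] by (simp add: algebra_simps)
    moreover have "real n * L \<le> f p + (real n - 1) * f y"
      using weighted_greater[OF n 2 y(3)] by simp
    ultimately show ?thesis using that[of y] mean[of y] y by simp
  qed
qed

lemma not_strict_mean:
  assumes n: "n \<ge> 2"
  shows "\<not> strict_mean I n (qa_mean I f n)"
proof
  assume strict: "strict_mean I n (qa_mean I f n)"
  obtain y where y: "y \<in> I" "y \<noteq> p" "qa_mean I f n (odd_one_out n p y) = p"
    using absorbing_neighbour[OF n] .
  have "odd_one_out n p y 1 \<noteq> odd_one_out n p y 2" using y n by (simp add: padded_def)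
  moreover have "1 \<in> {1..n}" "2 \<in> {1..n}" using n by auto
  ultimately have "\<exists>i\<in>{1..n}. \<exists>j\<in>{1..n}. odd_one_out n p y i \<noteq> odd_one_out n p y j" by blast
  moreover have "odd_one_out n p y \<in> {1..n} \<rightarrow>\<^sub>E I" using y p by (intro odd_one_out_in)
  ultimately have "Min {p, y} < p \<and> p < Max {p, y}"
    using strict y(3) image_odd_one_out[OF n, of p y] unfolding strict_mean_def by metis
  then show False by auto
qed

text \<open>
  Every additional \<open>z\<close> raises the excess over the multiple of \<open>R\<close> by \<open>f z - R\<close>. This step is chosen
  positive but smaller than \<open>hi - lo\<close>, so for some number \<open>N\<close> of steps the larger sum has already passed
  the threshold while the smaller one has not.
\<close>
lemma sums_distinguished:
  assumes lo: "2 * L \<le> lo" and lohi: "lo < hi" and hi: "hi \<le> 2 * R"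
  obtains N z where "N \<ge> 1" "z \<in> I" "p < z"
    "(2 + real N) * L \<le> lo + real N * f z" "lo + real N * f z \<le> (2 + real N) * R"
    "(2 + real N) * R < hi + real N * f z"
proof -
  obtain z where z: "z \<in> I" "p < z" "R < f z" "f z < R + (hi - lo)"
    using above[of "hi - lo"] lohi by auto
  define \<delta> where "\<delta> = f z - R"
  \<comment> \<open>The largest number of steps that keeps the smaller sum below the threshold.\<close>
  define N where "N = nat \<lfloor>(2 * R - lo) / \<delta>\<rfloor>"
  have \<delta>: "0 < \<delta>" "\<delta> < hi - lo" using z by (auto simp: \<delta>_def)
  have ge1: "(2 * R - lo) / \<delta> \<ge> 1" using \<delta> hi by (simp add: field_simps)
  then have N: "real N \<le> (2 * R - lo) / \<delta>" "(2 * R - lo) / \<delta> < real N + 1"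
    unfolding N_def by linarith+
  have "real N * \<delta> \<le> 2 * R - lo" "2 * R - lo < real N * \<delta> + \<delta>"
    using N \<delta> by (auto simp: field_simps)
  moreover have "real N * f z = real N * R + real N * \<delta>" by (simp add: \<delta>_def algebra_simps)
  moreover have "real N * L \<le> real N * f z" using z jump by (intro mult_left_mono) auto
  moreover have "N \<ge> 1" using ge1 unfolding N_def by linarith
  ultimately show ?thesis using that[of N z] z \<delta> lo by (simp add: algebra_simps)
qed

text \<open>
  For a suitable \<open>y \<noteq> p\<close> the mean of \<open>(p, y)\<close> is \<open>p\<close>, so associativity would identify the means of
  \<open>(p, y, z, \<dots>, z)\<close> and \<open>(p, p, z, \<dots>, z)\<close>. Since \<open>f p + f y \<noteq> 2 f(p)\<close>, they can be told apart by an
  appropriate tail of \<open>z\<close>'s.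
\<close>
lemma not_associative: "\<not> associative_means I (qa_mean I f)"
proof
  assume assoc: "associative_means I (qa_mean I f)"
  obtain y where y: "y \<in> I" "y \<noteq> p" "qa_mean I f 2 (odd_one_out 2 p y) = p"
    "2 * L \<le> f p + f y" "f p + f y \<le> 2 * R"
    using absorbing_neighbour[of 2] by auto
  define u where "u = (\<lambda>i::nat. if i \<le> 1 then p else y)"
  have sum_u: "(\<Sum>i=1..2. f (u i)) = f p + f y" by (simp add: u_def numeral_2_eq_2)
  have same: "qa_mean I f (2 + N) (padded (2 + N) 2 u z)
            = qa_mean I f (2 + N) (padded (2 + N) 2 (\<lambda>_. p) z)"
    if N: "N \<ge> 1" and z: "z \<in> I" for N z
  proof -
    let ?x = "padded (2 + N) 2 u z"
    have x: "?x \<in> {1..2 + N} \<rightarrow>\<^sub>E I" using y p z by (intro padded_in) (auto simp: u_def)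
    have "restrict ?x {1..2} = odd_one_out 2 p y"
      by (auto simp: padded_def u_def fun_eq_iff)
    then have head: "qa_mean I f 2 (restrict ?x {1..2}) = p" using y(3) by simp
    have "(\<lambda>i\<in>{1..2 + N}. if i \<le> 2 then p else ?x i) = padded (2 + N) 2 (\<lambda>_. p) z"
      by (auto simp: padded_def fun_eq_iff)
    moreover have "qa_mean I f (2 + N) ?x = qa_mean I f (2 + N)
        (\<lambda>i\<in>{1..2 + N}. if i \<le> 2 then qa_mean I f 2 (restrict ?x {1..2}) else ?x i)"
      by (rule assoc[unfolded associative_means_def Let_def, rule_format]) (use x N in auto)
    ultimately show ?thesis unfolding head by (simp only:)
  qed
  \<comment> \<open>Stated for two arbitrary heads because \<open>y\<close> may lie on either side of \<open>p\<close>.\<close>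
  have sep: False
    if ab: "\<And>i. v i \<in> I" "\<And>i. w i \<in> I"
    and lo: "2 * L \<le> (\<Sum>i=1..2. f (v i))" and hi: "(\<Sum>i=1..2. f (w i)) \<le> 2 * R"
    and less: "(\<Sum>i=1..2. f (v i)) < (\<Sum>i=1..2. f (w i))"
    and eq: "\<And>N z. N \<ge> 1 \<Longrightarrow> z \<in> I \<Longrightarrow> qa_mean I f (2 + N) (padded (2 + N) 2 v z)
                                     = qa_mean I f (2 + N) (padded (2 + N) 2 w z)"
    for v w :: "nat \<Rightarrow> real"
  proof -
    obtain N z where Nz: "N \<ge> 1" "z \<in> I"
      "(\<Sum>i=1..2. f (v i)) + real N * f z \<le> (2 + real N) * R"
      "(2 + real N) * R < (\<Sum>i=1..2. f (w i)) + real N * f z"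
      using sums_distinguished[OF lo less hi] by metis
    have "qa_mean I f (2 + N) (padded (2 + N) 2 v z) \<le> p"
      using Nz ab by (intro qa_mean_le_of_right_lim padded_in p) (simp_all only: sum_padded, auto)
    moreover have "p < qa_mean I f (2 + N) (padded (2 + N) 2 w z)"
      using Nz ab by (intro qa_mean_greater padded_in p) (simp_all only: sum_padded, auto)
    ultimately show False using eq[OF Nz(1,2)] by simp
  qed
  have uI: "u i \<in> I" for i using y p by (simp add: u_def)
  have sum_p: "(\<Sum>i=1..2::nat. f p) = 2 * f p" by simp
  have fy: "f y \<noteq> f p" using y(1,2) p less[of y p] less[of p y] by (cases y p rule: linorder_cases) auto
  consider "f y < f p" | "f p < f y" using fy by linarith
  then show False
  proof cases
    case 1
    show False
    proof (rule sep[of u "\<lambda>_. p"])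
      show "2 * L \<le> (\<Sum>i=1..2. f (u i))" unfolding sum_u by (rule y(4))
      show "(\<Sum>i=1..2::nat. f p) \<le> 2 * R" unfolding sum_p using le_right_lim[OF p] by simp
      show "(\<Sum>i=1..2. f (u i)) < (\<Sum>i=1..2::nat. f p)" unfolding sum_u sum_p using 1 by simp
    qed (fact uI p same)+
  next
    case 2
    show False
    proof (rule sep[of "\<lambda>_. p" u])
      show "2 * L \<le> (\<Sum>i=1..2::nat. f p)" unfolding sum_p using left_lim_le[OF p] by simp
      show "(\<Sum>i=1..2. f (u i)) \<le> 2 * R" unfolding sum_u by (rule y(5))
      show "(\<Sum>i=1..2::nat. f p) < (\<Sum>i=1..2. f (u i))" unfolding sum_u sum_p using 2 by simp
    qed (fact uI p same[symmetric])+
  qed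
qed

end

section \<open>Quasiarithmetic means of continuous functions\<close>

locale continuous_increasing = increasing_on_interval +
  assumes cont: "continuous_on I f"
begin

lemma hull_image: "C = f ` I"
proof -
  have "is_interval (f ` I)"
    using cont interval_I by (simp add: is_interval_connected_1 connected_continuous_image)
  then show ?thesis by (simp add: is_interval_convex_1 hull_same)
qed

text \<open>
  Here continuity enters: \<open>f(I)\<close> is an interval, so the average of values of \<open>f\<close> is itself a value of
  \<open>f\<close>, and the generalized inverse is an actual inverse there.
\<close>
lemma f_qa_mean:
  assumes "n \<ge> 1" "x \<in> {1..n} \<rightarrow>\<^sub>E I"
  shows "f (qa_mean I f n x) = (\<Sum>i=1..n. f (x i)) / real n"
  using mean_in_hull[OF assms] gen_inverse_props(3) unfolding hull_image qa_mean_def by auto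

lemma qa_mean_less_iff:
  assumes "n \<ge> 1" "x \<in> {1..n} \<rightarrow>\<^sub>E I" "p \<in> I"
  shows "qa_mean I f n x < p \<longleftrightarrow> (\<Sum>i=1..n. f (x i)) < real n * f p"
  using qa_mean_less[OF assms] qa_mean_ge[OF assms] continuous_imp_limits_eq[OF cont assms(3)]
  by force

lemma comparable: "comparable_continuous_qa I f n"
  unfolding comparable_continuous_qa_def using cont strict_mono by blast

lemma equal: "equals_continuous_qa I f n"
  unfolding equals_continuous_qa_def using cont strict_mono by blast

lemma qa_mean_continuous:
  assumes n: "n \<ge> 1"
  shows "continuous_on ({1..n} \<rightarrow>\<^sub>E I) (qa_mean I f n)"
proof -
  have "h ` C = I" using gen_inverse_props(1,3) unfolding hull_image by (force simp: image_image)
  \<comment> \<open>A monotone function with open image has no jumps.\<close>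
  then have "continuous_on C h"
    using open_I mono_onD[OF gen_inverse_props(2)] by (intro continuous_onI_mono) auto
  then show ?thesis
    unfolding qa_mean_def
  proof (rule continuous_on_compose2)
    show "continuous_on ({1..n} \<rightarrow>\<^sub>E I) (\<lambda>x. (\<Sum>i=1..n. f (x i)) / real n)"
    proof (intro continuous_intros)
      show "continuous_on ({1..n} \<rightarrow>\<^sub>E I) (\<lambda>x. f (x i))" if "i \<in> {1..n}" for i
      proof (rule continuous_on_compose2[OF cont])
        show "continuous_on ({1..n} \<rightarrow>\<^sub>E I) (\<lambda>x. x i)"
          by (rule continuous_on_subset[OF continuous_on_product_coordinates]) simp
      qed (use that in auto)
    qed (use n in simp)
    show "(\<lambda>x. (\<Sum>i=1..n. f (x i)) / real n) ` ({1..n} \<rightarrow>\<^sub>E I) \<subseteq> C"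
      using mean_in_hull[OF n] by blast
  qed
qed

lemma envelopes_le:
  assumes x: "x \<in> {1..n} \<rightarrow>\<^sub>E I"
  shows "qa_mean I (upper_env I f) n x \<le> qa_mean I (lower_env I f) n x"
proof -
  have env: "upper_env I f t = f t" "lower_env I f t = f t" if "t \<in> I" for t
    using that continuous_imp_limits_eq[OF cont that]
    by (simp_all add: upper_env_eq_right_lim lower_env_eq_left_lim)
  have inv: "gen_inverse I (upper_env I f) = h" "gen_inverse I (lower_env I f) = h"
    unfolding gen_inverse_def using env by (simp_all cong: image_cong)
  have "(\<Sum>i=1..n. upper_env I f (x i)) = (\<Sum>i=1..n. lower_env I f (x i))"
    by (intro sum.cong refl) (metis PiE_mem env x)
  then show ?thesis unfolding qa_mean_def inv by simp
qed

lemma strictly_increasing: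
  assumes n: "n \<ge> 1"
  shows "strict_mono_each_var I n (qa_mean I f n)"
  unfolding strict_mono_each_var_def
proof (intro ballI strict_mono_onI)
  fix x i s t assume x: "x \<in> {1..n} \<rightarrow>\<^sub>E I" and i: "i \<in> {1..n}" and st: "s \<in> I" "t \<in> I" "s < t"
  have upd: "x(i := r) \<in> {1..n} \<rightarrow>\<^sub>E I" if "r \<in> I" for r using x i that by (auto simp: PiE_iff extensional_def)
  have "(\<Sum>j=1..n. f ((x(i := s)) j)) < (\<Sum>j=1..n. f ((x(i := t)) j))"
    using i st less[of s t] by (intro sum_strict_mono_ex1) (auto intro!: bexI[of _ i])
  also have "\<dots> = real n * f (qa_mean I f n (x(i := t)))"
    using f_qa_mean[OF n upd[OF st(2)]] n by (simp add: field_simps)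
  finally show "qa_mean I f n (x(i := s)) < qa_mean I f n (x(i := t))"
    using qa_mean_less_iff[OF n upd[OF st(1)] qa_mean_in[OF n upd[OF st(2)]]] by simp
qed

lemma strict:
  assumes n: "n \<ge> 1"
  shows "strict_mean I n (qa_mean I f n)"
  unfolding strict_mean_def
proof (intro ballI impI)
  fix x assume x: "x \<in> {1..n} \<rightarrow>\<^sub>E I" and "\<exists>i\<in>{1..n}. \<exists>j\<in>{1..n}. x i \<noteq> x j"
  then obtain i j where ij: "i \<in> {1..n}" "j \<in> {1..n}" "x i < x j"
    by (metis linorder_neqE_linordered_idom)
  let ?lo = "Min (x ` {1..n})" and ?hi = "Max (x ` {1..n})"
  have ne: "x ` {1..n} \<noteq> {}" using n by simp
  have loI: "?lo \<in> I" and hiI: "?hi \<in> I" 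
    using Min_in[OF _ ne] Max_in[OF _ ne] x by (auto simp: PiE_iff)
  have bounds: "?lo \<le> x k" "x k \<le> ?hi" "x k \<in> I" if "k \<in> {1..n}" for k
    using that x by auto
  have "(\<Sum>k=1..n. f ?lo) < (\<Sum>k=1..n. f (x k))"
  proof (rule sum_strict_mono_ex1)
    show "\<forall>k\<in>{1..n}. f ?lo \<le> f (x k)" using bounds loI less_eq by blast
    have "?lo < x j" using bounds(1)[OF ij(1)] ij(3) by linarith
    then show "\<exists>k\<in>{1..n}. f ?lo < f (x k)" using less[OF loI bounds(3)] ij(2) by blast
  qed simp
  moreover have "(\<Sum>k=1..n. f (x k)) < (\<Sum>k=1..n. f ?hi)"
  proof (rule sum_strict_mono_ex1)
    show "\<forall>k\<in>{1..n}. f (x k) \<le> f ?hi" using bounds hiI less_eq by blast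
    have "x i < ?hi" using bounds(2)[OF ij(2)] ij(3) by linarith
    then show "\<exists>k\<in>{1..n}. f (x k) < f ?hi" using less[OF bounds(3) hiI] ij(1) by blast
  qed simp
  ultimately show "?lo < qa_mean I f n x \<and> qa_mean I f n x < ?hi"
    using qa_mean_greater[OF n x loI] qa_mean_less_iff[OF n x hiI]
      continuous_imp_limits_eq[OF cont loI] by simp
qed

text \<open>
  With \<open>y\<close> the mean of the first \<open>k\<close> entries, \<open>k f(y)\<close> is the sum of \<open>f\<close> over these entries, so
  replacing each of them by \<open>y\<close> does not change the total sum.
\<close>
lemma associative: "associative_means I (qa_mean I f)"
  unfolding associative_means_def Let_def
proof (intro allI impI ballI)
  fix n k :: nat and x
  assume n: "n \<ge> 1" and k: "k \<in> {1..n - 1}" and x: "x \<in> {1..n} \<rightarrow>\<^sub>E I"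
  let ?r = "restrict x {1..k}"
  define y where "y = qa_mean I f k ?r"
  have k': "k \<ge> 1" "k \<le> n" and r: "?r \<in> {1..k} \<rightarrow>\<^sub>E I" using k x by (auto simp: PiE_iff)
  have split: "{1..n} = {1..k} \<union> {k+1..n}" using k' by auto
  have sum_split: "(\<Sum>i=1..n. c i) = (\<Sum>i=1..k. c i) + (\<Sum>i=k+1..n. c i)" for c :: "nat \<Rightarrow> real"
    unfolding split by (rule sum.union_disjoint) auto
  have "real k * f y = (\<Sum>i=1..k. f (?r i))"
    using f_qa_mean[OF k'(1) r] k' unfolding y_def by simp
  also have "\<dots> = (\<Sum>i=1..k. f (x i))" by (rule sum.cong) auto
  finally have head: "real k * f y = (\<Sum>i=1..k. f (x i))" .
  have "(\<Sum>i=1..n. f ((\<lambda>i\<in>{1..n}. if i \<le> k then y else x i) i))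
      = (\<Sum>i=1..n. if i \<le> k then f y else f (x i))"
    by (rule sum.cong) auto
  also have "\<dots> = (\<Sum>i=1..k. f y) + (\<Sum>i=k+1..n. f (x i))"
    unfolding sum_split by (intro arg_cong2[of _ _ _ _ "(+)"] sum.cong) auto
  also have "\<dots> = (\<Sum>i=1..n. f (x i))" using sum_split[of "\<lambda>i. f (x i)"] head by simp
  finally show "qa_mean I f n x =
      qa_mean I f n (\<lambda>i\<in>{1..n}. if i \<le> k then qa_mean I f k ?r else x i)"
    unfolding qa_mean_def[of I f n] y_def by simp
qed

end

section \<open>The characterization theorem\<close>

theorem theorem2p6:
  fixes I :: "real set" and f :: "real \<Rightarrow> real"
  assumes "open I" and "is_interval I" and "I \<noteq> {}"
    and "strict_mono_on I f"
  shows "let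
         P1 = continuous_on I f;
         P2 = (\<exists>n\<ge>2. equals_continuous_qa I f n);
         P3 = (\<exists>n\<ge>2. comparable_continuous_qa I f n);
         P4 = (\<exists>n\<ge>2. continuous_on ({1..n} \<rightarrow>\<^sub>E I) (qa_mean I f n));
         P5 = (\<exists>n\<ge>2. \<forall>x \<in> {1..n} \<rightarrow>\<^sub>E I. qa_mean I (upper_env I f) n x \<le> qa_mean I (lower_env I f) n x);
         P6 = (\<exists>n\<ge>2. strict_mono_each_var I n (qa_mean I f n));
         P7 = (\<exists>n\<ge>2. strict_mean I n (qa_mean I f n));
         P8 = associative_means I (qa_mean I f)
       in
         ((P1 \<longleftrightarrow> P2) \<and> (P1 \<longleftrightarrow> P3) \<and> (P1 \<longleftrightarrow> P4) \<and> (P1 \<longleftrightarrow> P5) \<and>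
          (P1 \<longleftrightarrow> P6) \<and> (P1 \<longleftrightarrow> P7) \<and> (P1 \<longleftrightarrow> P8)) \<and>
         (P1 \<or> P2 \<or> P3 \<or> P4 \<or> P5 \<or> P6 \<or> P7 \<or> P8 \<longrightarrow>
            (\<forall>n\<ge>1. comparable_continuous_qa I f n \<and>
                   continuous_on ({1..n} \<rightarrow>\<^sub>E I) (qa_mean I f n) \<and>
                   (\<forall>x \<in> {1..n} \<rightarrow>\<^sub>E I.
                      qa_mean I (upper_env I f) n x \<le> qa_mean I (lower_env I f) n x) \<and>
                   strict_mono_each_var I n (qa_mean I f n) \<and>
                   strict_mean I n (qa_mean I f n)))"
proof -
  interpret increasing_on_interval I f using assms by unfold_locales
  show ?thesis
  proof (cases "continuous_on I f")
    case True
    then interpret continuous_increasing I f by unfold_locales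
    have "\<exists>n::nat. n \<ge> 2" by blast
    moreover have "n \<ge> 1" if "n \<ge> 2" for n :: nat using that by simp
    ultimately show ?thesis
      unfolding Let_def
      using True comparable equal qa_mean_continuous envelopes_le strictly_increasing strict associative
      by meson
  next
    case False
    then obtain p where "p \<in> I" "left_lim I f p < right_lim I f p"
      using discontinuous_imp_jump by blast
    then interpret jump I f p by unfold_locales
    have "\<not> equals_continuous_qa I f n" if "n \<ge> 2" for n
      using not_comparable[OF that]
      unfolding equals_continuous_qa_def comparable_continuous_qa_def by (metis order_refl)
    then show ?thesis
      unfolding Let_def
      using False not_comparable not_continuous not_envelopes_le not_strict_mono_each_var
        not_strict_mean not_associative
      by meson
  qed
qed

end
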